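(* Let $\{\top\}$ be the terminal category endowed with the trivial model structure. The unique functor $!\colon\mathrm{DblCat}_{\mathrm{ctr}}\to\{\top\}$ has a left adjoint picking out the empty double category $\emptyset$ and a right adjoint picking out the terminal double category $\mathbf 1$, and both adjunctions $\emptyset\dashv{!}$ and ${!}\dashv\mathbf 1$ are Quillen equivalences between $\mathrm{DblCat}_{\mathrm{ctr}}$ and $\{\top\}$.
   Context: **Double categories.** All double categories are small and strict (internal categories in $\mathrm{Cat}$): they have objects, horizontal morphisms, vertical morphisms, and squares, each square having a top and a bottom horizontal morphism and a left and a right vertical morphism. $\mathrm{DblCat}$ is the category of double categories and double functors; $\mathbf 1$ is the terminal double category. $\alpha\vert\beta$ is the horizontal composite ($\alpha$ to the left of $\beta$), $\frac{\alpha}{\beta}$ the vertical composite ($\alpha$ above $\beta$); $e_f$ is the vertical identity square at a horizontal morphism $f$, $\mathrm{id}_u$ the horizontal identity square at a vertical morphism $u$. A double functor is a *canonical trivial fibration* if it is surjective on objects, full on horizontal and on vertical morphisms, and fully faithful on squares (bijective on squares with any given boundary in the source). **Gregarious equivalences.** $\mathbf H\mathbb A$ is the underlying horizontal 2-category of $\mathbb A$ (objects, horizontal morphisms, and as 2-morphisms the squares whose left and right sides are identities), $\mathbf V\mathbb A$ the underlying vertical 2-category (directions exchanged). A *companion pair* $(f,u,\varphi,\psi)$ consists of a horizontal morphism $f\colon A\to B$, a vertical morphism $u$ from $A$ to $B$, a square $\varphi$ with top $f$, left $u$, bottom and right identities at $B$, and a square $\psi$ with top and left identities at $A$, bottom $f$,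 right $u$, such that $\psi\vert\varphi=e_f$ and $\frac{\psi}{\varphi}=\mathrm{id}_u$. $\mathbf R\mathbb A$ is the 2-category with the objects of $\mathbb A$, companion pairs as morphisms, and as 2-morphisms $(f,u,\varphi,\psi)\Rightarrow(f',u',\varphi',\psi')$ the squares with top $f$, bottom $f'$ and identity left and right sides. A *gregarious equivalence* is a companion pair that is an equivalence in $\mathbf R\mathbb A$. A double functor $F\colon\mathbb A\to\mathbb B$ is a *gregarious double equivalence* if every object $B\in\mathbb B$ admits a gregarious equivalence $FA\to B$ for some $A\in\mathbb A$, the 2-functors $\mathbf HF$ and $\mathbf VF$ are essentially full on morphisms, and $F$ is fully faithful on squares. **Model structure.** $\mathrm{DblCat}_{\mathrm{ctr}}$ is the (existing, unique, cofibrantly generated) model structure on $\mathrm{DblCat}$ whose trivial fibrations are the canonical ones and whose fibrant objects are the double categories $\mathbb A$ such that $\mathbb A\to\mathbf 1$ is a gregarious double equivalence. Its weak equivalences between fibrant objects are the gregarious double equivalences. *)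

theory Defs
  imports Main "HOL-Library.FuncSet"
begin

unbundle cardinal_syntax

section \<open>Categories and functors\<close>

text \<open>Composition is written in diagrammatic order throughout: \<open>Seq C f g\<close> is ``first \<open>f\<close>, then \<open>g\<close>''.\<close>

record ('o, 'm) cat =
  Obj :: "'o set"
  Arr :: "'m set"
  Src :: "'m \<Rightarrow> 'o"
  Tgt :: "'m \<Rightarrow> 'o"
  Idn :: "'o \<Rightarrow> 'm"
  Seq :: "'m \<Rightarrow> 'm \<Rightarrow> 'm"

definition hom :: "('o, 'm) cat \<Rightarrow> 'o \<Rightarrow> 'o \<Rightarrow> 'm set" where
  "hom C X Y = {f \<in> Arr C. Src C f = X \<and> Tgt C f = Y}"

locale category =
  fixes C :: "('o, 'm) cat"
  assumes src_closed: "f \<in> Arr C \<Longrightarrow> Src C f \<in> Obj C"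
    and tgt_closed: "f \<in> Arr C \<Longrightarrow> Tgt C f \<in> Obj C"
    and idn_hom: "X \<in> Obj C \<Longrightarrow> Idn C X \<in> hom C X X"
    and seq_hom: "\<lbrakk>f \<in> hom C X Y; g \<in> hom C Y Z\<rbrakk> \<Longrightarrow> Seq C f g \<in> hom C X Z"
    and idn_left: "f \<in> hom C X Y \<Longrightarrow> Seq C (Idn C X) f = f"
    and idn_right: "f \<in> hom C X Y \<Longrightarrow> Seq C f (Idn C Y) = f"
    and seq_assoc: "\<lbrakk>f \<in> hom C W X; g \<in> hom C X Y; h \<in> hom C Y Z\<rbrakk>
      \<Longrightarrow> Seq C (Seq C f g) h = Seq C f (Seq C g h)"

definition opposite :: "('o, 'm) cat \<Rightarrow> ('o, 'm) cat" where
  "opposite C = \<lparr>Obj = Obj C, Arr = Arr C, Src = Tgt C, Tgt = Src C, Idn = Idn C,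
     Seq = (\<lambda>f g. Seq C g f)\<rparr>"

definition iso_arrow :: "('o, 'm) cat \<Rightarrow> 'm \<Rightarrow> bool" where
  "iso_arrow C f \<longleftrightarrow> f \<in> Arr C \<and> (\<exists>g \<in> hom C (Tgt C f) (Src C f).
     Seq C f g = Idn C (Src C f) \<and> Seq C g f = Idn C (Tgt C f))"

definition isomorphic :: "('o, 'm) cat \<Rightarrow> 'o \<Rightarrow> 'o \<Rightarrow> bool" where
  "isomorphic C X Y \<longleftrightarrow> (\<exists>f \<in> hom C X Y. iso_arrow C f)"

record ('o, 'm, 'p, 'n) ftor =
  fobj :: "'o \<Rightarrow> 'p"
  farr :: "'m \<Rightarrow> 'n"

locale is_functor = source: category C + target: category D
  for C :: "('o, 'm) cat" and D :: "('p, 'n) cat" +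
  fixes F :: "('o, 'm, 'p, 'n) ftor"
  assumes fobj_closed: "X \<in> Obj C \<Longrightarrow> fobj F X \<in> Obj D"
    and farr_hom: "f \<in> hom C X Y \<Longrightarrow> farr F f \<in> hom D (fobj F X) (fobj F Y)"
    and farr_idn: "X \<in> Obj C \<Longrightarrow> farr F (Idn C X) = Idn D (fobj F X)"
    and farr_seq: "\<lbrakk>f \<in> hom C X Y; g \<in> hom C Y Z\<rbrakk>
      \<Longrightarrow> farr F (Seq C f g) = Seq D (farr F f) (farr F g)"

locale adjunction = left: is_functor C D F + right: is_functor D C G
  for C :: "('o, 'm) cat" and D :: "('p, 'n) cat"
    and F :: "('o, 'm, 'p, 'n) ftor" and G :: "('p, 'n, 'o, 'm) ftor" +
  fixes unit :: "'o \<Rightarrow> 'm" and counit :: "'p \<Rightarrow> 'n"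
  assumes unit_hom: "X \<in> Obj C \<Longrightarrow> unit X \<in> hom C X (fobj G (fobj F X))"
    and unit_natural: "f \<in> hom C X X' \<Longrightarrow>
      Seq C f (unit X') = Seq C (unit X) (farr G (farr F f))"
    and counit_hom: "Y \<in> Obj D \<Longrightarrow> counit Y \<in> hom D (fobj F (fobj G Y)) Y"
    and counit_natural: "g \<in> hom D Y Y' \<Longrightarrow>
      Seq D (farr F (farr G g)) (counit Y') = Seq D (counit Y) g"
    and triangle_left: "X \<in> Obj C \<Longrightarrow>
      Seq D (farr F (unit X)) (counit (fobj F X)) = Idn D (fobj F X)"
    and triangle_right: "Y \<in> Obj D \<Longrightarrow>
      Seq C (unit (fobj G Y)) (farr G (counit Y)) = Idn C (fobj G Y)"

definition is_terminal :: "('o, 'm) cat \<Rightarrow> 'o \<Rightarrow> bool" where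
  "is_terminal C T \<longleftrightarrow> T \<in> Obj C \<and> (\<forall>X \<in> Obj C. \<exists>!f. f \<in> hom C X T)"

definition is_cone ::
  "('i, 'a) cat \<Rightarrow> ('o, 'm) cat \<Rightarrow> ('i, 'a, 'o, 'm) ftor \<Rightarrow> 'o \<Rightarrow> ('i \<Rightarrow> 'm) \<Rightarrow> bool" where
  "is_cone J C D X l \<longleftrightarrow> X \<in> Obj C \<and> (\<forall>j \<in> Obj J. l j \<in> hom C X (fobj D j)) \<and>
     (\<forall>a \<in> Arr J. Seq C (l (Src J a)) (farr D a) = l (Tgt J a))"

definition is_limit ::
  "('i, 'a) cat \<Rightarrow> ('o, 'm) cat \<Rightarrow> ('i, 'a, 'o, 'm) ftor \<Rightarrow> 'o \<Rightarrow> ('i \<Rightarrow> 'm) \<Rightarrow> bool" where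
  "is_limit J C D X l \<longleftrightarrow> is_cone J C D X l \<and>
     (\<forall>Y m. is_cone J C D Y m \<longrightarrow>
       (\<exists>!h. h \<in> hom C Y X \<and> (\<forall>j \<in> Obj J. Seq C h (l j) = m j)))"

text \<open>Every finite category is isomorphic to one whose objects and arrows are natural numbers.\<close>

definition has_finite_limits :: "('o, 'm) cat \<Rightarrow> bool" where
  "has_finite_limits C \<longleftrightarrow>
     (\<forall>(J :: (nat, nat) cat) D. finite (Obj J) \<and> finite (Arr J) \<and> is_functor J C D \<longrightarrow>
       (\<exists>X l. is_limit J C D X l))"

definition has_finite_colimits :: "('o, 'm) cat \<Rightarrow> bool" where
  "has_finite_colimits C \<longleftrightarrow> has_finite_limits (opposite C)"


section \<open>Model structures and Quillen equivalences\<close>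

definition lifts_against :: "('o, 'm) cat \<Rightarrow> 'm \<Rightarrow> 'm \<Rightarrow> bool" where
  "lifts_against C i p \<longleftrightarrow>
     (\<forall>u \<in> hom C (Src C i) (Src C p). \<forall>v \<in> hom C (Tgt C i) (Tgt C p).
        Seq C u p = Seq C i v \<longrightarrow>
        (\<exists>h \<in> hom C (Tgt C i) (Src C p). Seq C i h = u \<and> Seq C h p = v))"

definition weak_factorization_system :: "('o, 'm) cat \<Rightarrow> 'm set \<Rightarrow> 'm set \<Rightarrow> bool" where
  "weak_factorization_system C L R \<longleftrightarrow>
     L = {i \<in> Arr C. \<forall>p \<in> R. lifts_against C i p} \<and>
     R = {p \<in> Arr C. \<forall>i \<in> L. lifts_against C i p} \<and>
     (\<forall>f \<in> Arr C. \<exists>i \<in> L. \<exists>p \<in> R. Tgt C i = Src C p \<and> Seq C i p = f)"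

definition two_out_of_three :: "('o, 'm) cat \<Rightarrow> 'm set \<Rightarrow> bool" where
  "two_out_of_three C W \<longleftrightarrow>
     (\<forall>f \<in> Arr C. \<forall>g \<in> Arr C. Tgt C f = Src C g \<longrightarrow>
        (f \<in> W \<and> g \<in> W \<longrightarrow> Seq C f g \<in> W) \<and>
        (f \<in> W \<and> Seq C f g \<in> W \<longrightarrow> g \<in> W) \<and>
        (g \<in> W \<and> Seq C f g \<in> W \<longrightarrow> f \<in> W))"

record 'm model =
  weq :: "'m set"
  cof :: "'m set"
  fib :: "'m set"

text \<open>Model structures in the formulation of Joyal and Tierney. As in Quillen's original
  definition only finite limits and colimits are demanded. Closure of the three classes
  under retracts is a consequence.\<close>

locale model_category = category C for C :: "('o, 'm) cat" +
  fixes M :: "'m model"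
  assumes finite_limits: "has_finite_limits C"
    and finite_colimits: "has_finite_colimits C"
    and weq_arr: "weq M \<subseteq> Arr C"
    and weq_two_out_of_three: "two_out_of_three C (weq M)"
    and trivial_cof_fib: "weak_factorization_system C (cof M \<inter> weq M) (fib M)"
    and cof_trivial_fib: "weak_factorization_system C (cof M) (fib M \<inter> weq M)"

definition fibrant :: "('o, 'm) cat \<Rightarrow> 'm model \<Rightarrow> 'o \<Rightarrow> bool" where
  "fibrant C M X \<longleftrightarrow> X \<in> Obj C \<and> (\<exists>T. is_terminal C T \<and> (\<exists>f \<in> hom C X T. f \<in> fib M))"

definition cofibrant :: "('o, 'm) cat \<Rightarrow> 'm model \<Rightarrow> 'o \<Rightarrow> bool" where
  "cofibrant C M X \<longleftrightarrow> X \<in> Obj C \<and>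
     (\<exists>I. is_terminal (opposite C) I \<and> (\<exists>f \<in> hom C I X. f \<in> cof M))"

definition trivial_model :: "('o, 'm) cat \<Rightarrow> 'm model" where
  "trivial_model C = \<lparr>weq = {f. iso_arrow C f}, cof = Arr C, fib = Arr C\<rparr>"

text \<open>\<open>F\<close> is the left adjoint, from \<open>(C, M)\<close> to \<open>(D, N)\<close>, and \<open>G\<close> is the right adjoint.\<close>

locale quillen_adjunction =
  source_model: model_category C M + target_model: model_category D N +
  adjunction C D F G unit counit
  for C :: "('o, 'm) cat" and M :: "'m model" and D :: "('p, 'n) cat" and N :: "'n model"
    and F :: "('o, 'm, 'p, 'n) ftor" and G :: "('p, 'n, 'o, 'm) ftor"
    and unit :: "'o \<Rightarrow> 'm" and counit :: "'p \<Rightarrow> 'n" +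
  assumes preserves_cof: "farr F ` cof M \<subseteq> cof N"
    and preserves_trivial_cof: "farr F ` (cof M \<inter> weq M) \<subseteq> cof N \<inter> weq N"

definition quillen_equivalence ::
  "('o, 'm) cat \<Rightarrow> 'm model \<Rightarrow> ('p, 'n) cat \<Rightarrow> 'n model \<Rightarrow>
   ('o, 'm, 'p, 'n) ftor \<Rightarrow> ('p, 'n, 'o, 'm) ftor \<Rightarrow> bool" where
  "quillen_equivalence C M D N F G \<longleftrightarrow>
     (\<exists>unit counit. quillen_adjunction C M D N F G unit counit \<and>
       (\<forall>X Y. cofibrant C M X \<and> fibrant D N Y \<longrightarrow>
         (\<forall>f \<in> hom D (fobj F X) Y. f \<in> weq N \<longleftrightarrow> Seq C (unit X) (farr G f) \<in> weq M)))"


section \<open>Double categories\<close>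

text \<open>\<open>sqt\<close>, \<open>sqb\<close>, \<open>sql\<close>, \<open>sqr\<close> are the top, bottom (horizontal) and left, right (vertical)
  sides of a square. The horizontal composite \<open>\<alpha> | \<beta>\<close> is \<open>hpaste A \<alpha> \<beta>\<close>, the vertical composite (\<open>\<alpha>\<close> above \<open>\<beta>\<close>) is \<open>vpaste A \<alpha> \<beta>\<close>,
  \<open>e\<^sub>f\<close> is \<open>vidsq A f\<close> and \<open>id\<^sub>u\<close> is \<open>hidsq A u\<close>.\<close>

record ('o, 'h, 'v, 's) dblcat =
  Ob :: "'o set"
  Hor :: "'h set"
  Ver :: "'v set"
  Sq :: "'s set"
  hsrc :: "'h \<Rightarrow> 'o"
  htgt :: "'h \<Rightarrow> 'o"
  hid :: "'o \<Rightarrow> 'h"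
  hseq :: "'h \<Rightarrow> 'h \<Rightarrow> 'h"
  vsrc :: "'v \<Rightarrow> 'o"
  vtgt :: "'v \<Rightarrow> 'o"
  vid :: "'o \<Rightarrow> 'v"
  vseq :: "'v \<Rightarrow> 'v \<Rightarrow> 'v"
  sqt :: "'s \<Rightarrow> 'h"
  sqb :: "'s \<Rightarrow> 'h"
  sql :: "'s \<Rightarrow> 'v"
  sqr :: "'s \<Rightarrow> 'v"
  hidsq :: "'v \<Rightarrow> 's"
  hpaste :: "'s \<Rightarrow> 's \<Rightarrow> 's"
  vidsq :: "'h \<Rightarrow> 's"
  vpaste :: "'s \<Rightarrow> 's \<Rightarrow> 's"

definition hor_cat :: "('o, 'h, 'v, 's) dblcat \<Rightarrow> ('o, 'h) cat" where
  "hor_cat A = \<lparr>Obj = Ob A, Arr = Hor A, Src = hsrc A, Tgt = htgt A, Idn = hid A, Seq = hseq A\<rparr>"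

definition ver_cat :: "('o, 'h, 'v, 's) dblcat \<Rightarrow> ('o, 'v) cat" where
  "ver_cat A = \<lparr>Obj = Ob A, Arr = Ver A, Src = vsrc A, Tgt = vtgt A, Idn = vid A, Seq = vseq A\<rparr>"

definition hsq_cat :: "('o, 'h, 'v, 's) dblcat \<Rightarrow> ('v, 's) cat" where
  "hsq_cat A = \<lparr>Obj = Ver A, Arr = Sq A, Src = sql A, Tgt = sqr A, Idn = hidsq A, Seq = hpaste A\<rparr>"

definition vsq_cat :: "('o, 'h, 'v, 's) dblcat \<Rightarrow> ('h, 's) cat" where
  "vsq_cat A = \<lparr>Obj = Hor A, Arr = Sq A, Src = sqt A, Tgt = sqb A, Idn = vidsq A, Seq = vpaste A\<rparr>"

text \<open>An internal category in the category of categories: the category of objects is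
  \<open>hor_cat A\<close>, the category of morphisms is \<open>hsq_cat A\<close>. The functors in the first two
  assumptions are its source and target, \<open>vid_functor\<close> gives its identities, and the remaining
  assumptions say that its composition (\<open>vseq\<close>, \<open>vpaste\<close>) is an associative and unital functor.\<close>

locale double_category =
  fixes A :: "('o, 'h, 'v, 's) dblcat"
  assumes top_functor: "is_functor (hsq_cat A) (hor_cat A) \<lparr>fobj = vsrc A, farr = sqt A\<rparr>"
    and bottom_functor: "is_functor (hsq_cat A) (hor_cat A) \<lparr>fobj = vtgt A, farr = sqb A\<rparr>"
    and vid_functor: "is_functor (hor_cat A) (hsq_cat A) \<lparr>fobj = vid A, farr = vidsq A\<rparr>"
    and left_functor: "is_functor (vsq_cat A) (ver_cat A) \<lparr>fobj = hsrc A, farr = sql A\<rparr>"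
    and right_functor: "is_functor (vsq_cat A) (ver_cat A) \<lparr>fobj = htgt A, farr = sqr A\<rparr>"
    and hid_functor: "is_functor (ver_cat A) (vsq_cat A) \<lparr>fobj = hid A, farr = hidsq A\<rparr>"
    and interchange: "\<lbrakk>\<alpha> \<in> Sq A; \<beta> \<in> Sq A; \<gamma> \<in> Sq A; \<delta> \<in> Sq A; sqr A \<alpha> = sql A \<beta>; sqr A \<gamma> = sql A \<delta>;
        sqb A \<alpha> = sqt A \<gamma>; sqb A \<beta> = sqt A \<delta>\<rbrakk>
      \<Longrightarrow> vpaste A (hpaste A \<alpha> \<beta>) (hpaste A \<gamma> \<delta>) = hpaste A (vpaste A \<alpha> \<gamma>) (vpaste A \<beta> \<delta>)"

record ('o, 'h, 'v, 's, 'p, 'i, 'w, 't) dblfun =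
  dob :: "'o \<Rightarrow> 'p"
  dhor :: "'h \<Rightarrow> 'i"
  dver :: "'v \<Rightarrow> 'w"
  dsq :: "'s \<Rightarrow> 't"

locale double_functor = source: double_category A + target: double_category B
  for A :: "('o, 'h, 'v, 's) dblcat" and B :: "('p, 'i, 'w, 't) dblcat" +
  fixes F :: "('o, 'h, 'v, 's, 'p, 'i, 'w, 't) dblfun"
  assumes hor_functor: "is_functor (hor_cat A) (hor_cat B) \<lparr>fobj = dob F, farr = dhor F\<rparr>"
    and ver_functor: "is_functor (ver_cat A) (ver_cat B) \<lparr>fobj = dob F, farr = dver F\<rparr>"
    and hsq_functor: "is_functor (hsq_cat A) (hsq_cat B) \<lparr>fobj = dver F, farr = dsq F\<rparr>"
    and vsq_functor: "is_functor (vsq_cat A) (vsq_cat B) \<lparr>fobj = dhor F, farr = dsq F\<rparr>"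

definition bounded_squares ::
  "('o, 'h, 'v, 's) dblcat \<Rightarrow> 'h \<Rightarrow> 'h \<Rightarrow> 'v \<Rightarrow> 'v \<Rightarrow> 's set" where
  "bounded_squares A f f' u u' =
     {\<alpha> \<in> Sq A. sqt A \<alpha> = f \<and> sqb A \<alpha> = f' \<and> sql A \<alpha> = u \<and> sqr A \<alpha> = u'}"

definition fully_faithful_on_squares ::
  "('o, 'h, 'v, 's) dblcat \<Rightarrow> ('p, 'i, 'w, 't) dblcat \<Rightarrow>
   ('o, 'h, 'v, 's, 'p, 'i, 'w, 't) dblfun \<Rightarrow> bool" where
  "fully_faithful_on_squares A B F \<longleftrightarrow>
     (\<forall>f \<in> Hor A. \<forall>f' \<in> Hor A. \<forall>u \<in> Ver A. \<forall>u' \<in> Ver A.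
        hsrc A f = vsrc A u \<and> htgt A f = vsrc A u' \<and> hsrc A f' = vtgt A u \<and> htgt A f' = vtgt A u' \<longrightarrow>
        bij_betw (dsq F) (bounded_squares A f f' u u')
          (bounded_squares B (dhor F f) (dhor F f') (dver F u) (dver F u')))"

definition canonical_trivial_fibration ::
  "('o, 'h, 'v, 's) dblcat \<Rightarrow> ('p, 'i, 'w, 't) dblcat \<Rightarrow>
   ('o, 'h, 'v, 's, 'p, 'i, 'w, 't) dblfun \<Rightarrow> bool" where
  "canonical_trivial_fibration A B F \<longleftrightarrow> double_functor A B F \<and>
     dob F ` Ob A = Ob B \<and>
     (\<forall>X \<in> Ob A. \<forall>Y \<in> Ob A.
        dhor F ` hom (hor_cat A) X Y = hom (hor_cat B) (dob F X) (dob F Y)) \<and>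
     (\<forall>X \<in> Ob A. \<forall>Y \<in> Ob A.
        dver F ` hom (ver_cat A) X Y = hom (ver_cat B) (dob F X) (dob F Y)) \<and>
     fully_faithful_on_squares A B F"


section \<open>Underlying 2-categories\<close>

text \<open>A 2-category is given by its category of objects and 1-morphisms, the disjoint union
  \<open>homs\<close> of its hom-categories (objects: 1-morphisms, arrows: 2-morphisms), and the
  horizontal composition of 2-morphisms.\<close>

record ('o, 'm, 'c) twocat =
  under :: "('o, 'm) cat"
  homs :: "('m, 'c) cat"
  hcmp :: "'c \<Rightarrow> 'c \<Rightarrow> 'c"

record ('o, 'm, 'c, 'p, 'n, 'd) twofun =
  on_obj :: "'o \<Rightarrow> 'p"
  on_mor :: "'m \<Rightarrow> 'n"
  on_cell :: "'c \<Rightarrow> 'd"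

definition equivalence_in :: "('o, 'm, 'c) twocat \<Rightarrow> 'm \<Rightarrow> bool" where
  "equivalence_in K f \<longleftrightarrow> f \<in> Arr (under K) \<and>
     (\<exists>g \<in> hom (under K) (Tgt (under K) f) (Src (under K) f).
        isomorphic (homs K) (Idn (under K) (Src (under K) f)) (Seq (under K) f g) \<and>
        isomorphic (homs K) (Seq (under K) g f) (Idn (under K) (Tgt (under K) f)))"

definition essentially_full_on_morphisms ::
  "('o, 'm, 'c) twocat \<Rightarrow> ('p, 'n, 'd) twocat \<Rightarrow> ('o, 'm, 'c, 'p, 'n, 'd) twofun \<Rightarrow> bool" where
  "essentially_full_on_morphisms K L F \<longleftrightarrow>
     (\<forall>X \<in> Obj (under K). \<forall>Y \<in> Obj (under K). \<forall>g \<in> hom (under L) (on_obj F X) (on_obj F Y).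
        \<exists>f \<in> hom (under K) X Y. isomorphic (homs L) (on_mor F f) g)"

definition horizontal_2cat :: "('o, 'h, 'v, 's) dblcat \<Rightarrow> ('o, 'h, 's) twocat" where
  "horizontal_2cat A =
     \<lparr>under = hor_cat A,
      homs = \<lparr>Obj = Hor A, Arr = {\<alpha> \<in> Sq A. sql A \<alpha> \<in> vid A ` Ob A \<and> sqr A \<alpha> \<in> vid A ` Ob A},
        Src = sqt A, Tgt = sqb A, Idn = vidsq A, Seq = vpaste A\<rparr>,
      hcmp = hpaste A\<rparr>"

definition horizontal_2fun ::
  "('o, 'h, 'v, 's, 'p, 'i, 'w, 't) dblfun \<Rightarrow> ('o, 'h, 's, 'p, 'i, 't) twofun" where
  "horizontal_2fun F = \<lparr>on_obj = dob F, on_mor = dhor F, on_cell = dsq F\<rparr>"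

definition transpose :: "('o, 'h, 'v, 's) dblcat \<Rightarrow> ('o, 'v, 'h, 's) dblcat" where
  "transpose A =
     \<lparr>Ob = Ob A, Hor = Ver A, Ver = Hor A, Sq = Sq A,
      hsrc = vsrc A, htgt = vtgt A, hid = vid A, hseq = vseq A,
      vsrc = hsrc A, vtgt = htgt A, vid = hid A, vseq = hseq A,
      sqt = sql A, sqb = sqr A, sql = sqt A, sqr = sqb A,
      hidsq = vidsq A, hpaste = vpaste A, vidsq = hidsq A, vpaste = hpaste A\<rparr>"

definition transpose_fun ::
  "('o, 'h, 'v, 's, 'p, 'i, 'w, 't) dblfun \<Rightarrow> ('o, 'v, 'h, 's, 'p, 'w, 'i, 't) dblfun" where
  "transpose_fun F = \<lparr>dob = dob F, dhor = dver F, dver = dhor F, dsq = dsq F\<rparr>"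

definition vertical_2cat :: "('o, 'h, 'v, 's) dblcat \<Rightarrow> ('o, 'v, 's) twocat" where
  "vertical_2cat A = horizontal_2cat (transpose A)"

definition vertical_2fun ::
  "('o, 'h, 'v, 's, 'p, 'i, 'w, 't) dblfun \<Rightarrow> ('o, 'v, 's, 'p, 'w, 't) twofun" where
  "vertical_2fun F = horizontal_2fun (transpose_fun F)"


section \<open>Companion pairs and gregarious equivalences\<close>

record ('h, 'v, 's) companion =
  cphor :: 'h
  cpver :: 'v
  cpphi :: 's
  cppsi :: 's

definition companion_pair :: "('o, 'h, 'v, 's) dblcat \<Rightarrow> ('h, 'v, 's) companion \<Rightarrow> bool" where
  "companion_pair A p \<longleftrightarrow>
     (let f = cphor p; u = cpver p; X = hsrc A f; Y = htgt A f in
       f \<in> Hor A \<and> u \<in> hom (ver_cat A) X Y \<and>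
       cpphi p \<in> bounded_squares A f (hid A Y) u (vid A Y) \<and>
       cppsi p \<in> bounded_squares A (hid A X) f (vid A X) u \<and>
       hpaste A (cppsi p) (cpphi p) = vidsq A f \<and>
       vpaste A (cppsi p) (cpphi p) = hidsq A u)"

definition companion_id :: "('o, 'h, 'v, 's) dblcat \<Rightarrow> 'o \<Rightarrow> ('h, 'v, 's) companion" where
  "companion_id A X = \<lparr>cphor = hid A X, cpver = vid A X,
     cpphi = vidsq A (hid A X), cppsi = vidsq A (hid A X)\<rparr>"

text \<open>For composable companion pairs \<open>(f, u, \<phi>, \<psi>)\<close> and \<open>(g, v, \<phi>', \<psi>')\<close>, the structure squares
  of the composite are the pastings of the 2 by 2 grids with rows \<open>\<phi> | e\<^sub>g\<close>, \<open>id\<^sub>v | \<phi>'\<close> and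
  \<open>\<psi> | id\<^sub>u\<close>, \<open>e\<^sub>f | \<psi>'\<close>, respectively.\<close>

definition companion_seq ::
  "('o, 'h, 'v, 's) dblcat \<Rightarrow> ('h, 'v, 's) companion \<Rightarrow> ('h, 'v, 's) companion \<Rightarrow>
   ('h, 'v, 's) companion" where
  "companion_seq A p q =
     \<lparr>cphor = hseq A (cphor p) (cphor q), cpver = vseq A (cpver p) (cpver q),
      cpphi = vpaste A (hpaste A (cpphi p) (vidsq A (cphor q))) (hpaste A (hidsq A (cpver q)) (cpphi q)),
      cppsi = vpaste A (hpaste A (cppsi p) (hidsq A (cpver p))) (hpaste A (vidsq A (cphor p)) (cppsi q))\<rparr>"

text \<open>A 2-morphism \<open>p \<Rightarrow> p'\<close> is a triple \<open>(p, \<alpha>, p')\<close>, since the square \<open>\<alpha>\<close> does not determine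
  the companion pairs.\<close>

definition companion_2cat :: "('o, 'h, 'v, 's) dblcat \<Rightarrow>
    ('o, ('h, 'v, 's) companion,
     ('h, 'v, 's) companion \<times> 's \<times> ('h, 'v, 's) companion) twocat" where
  "companion_2cat A =
     \<lparr>under = \<lparr>Obj = Ob A, Arr = {p. companion_pair A p},
        Src = (\<lambda>p. hsrc A (cphor p)), Tgt = (\<lambda>p. htgt A (cphor p)),
        Idn = companion_id A, Seq = companion_seq A\<rparr>,
      homs = \<lparr>Obj = {p. companion_pair A p},
        Arr = {(p, \<alpha>, p'). companion_pair A p \<and> companion_pair A p' \<and>
          \<alpha> \<in> Arr (homs (horizontal_2cat A)) \<and> sqt A \<alpha> = cphor p \<and> sqb A \<alpha> = cphor p'},
        Src = (\<lambda>(p, \<alpha>, p'). p), Tgt = (\<lambda>(p, \<alpha>, p'). p'),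
        Idn = (\<lambda>p. (p, vidsq A (cphor p), p)),
        Seq = (\<lambda>(p, \<alpha>, p') (q, \<beta>, q'). (p, vpaste A \<alpha> \<beta>, q'))\<rparr>,
      hcmp = (\<lambda>(p, \<alpha>, p') (q, \<beta>, q'). (companion_seq A p q, hpaste A \<alpha> \<beta>, companion_seq A p' q'))\<rparr>"

definition gregarious_equivalence ::
  "('o, 'h, 'v, 's) dblcat \<Rightarrow> ('h, 'v, 's) companion \<Rightarrow> bool" where
  "gregarious_equivalence A p \<longleftrightarrow> companion_pair A p \<and> equivalence_in (companion_2cat A) p"

definition gregarious_double_equivalence ::
  "('o, 'h, 'v, 's) dblcat \<Rightarrow> ('p, 'i, 'w, 't) dblcat \<Rightarrow>
   ('o, 'h, 'v, 's, 'p, 'i, 'w, 't) dblfun \<Rightarrow> bool" where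
  "gregarious_double_equivalence A B F \<longleftrightarrow> double_functor A B F \<and>
     (\<forall>Y \<in> Ob B. \<exists>X \<in> Ob A. \<exists>p. gregarious_equivalence B p \<and>
        hsrc B (cphor p) = dob F X \<and> htgt B (cphor p) = Y) \<and>
     essentially_full_on_morphisms (horizontal_2cat A) (horizontal_2cat B) (horizontal_2fun F) \<and>
     essentially_full_on_morphisms (vertical_2cat A) (vertical_2cat B) (vertical_2fun F) \<and>
     fully_faithful_on_squares A B F"


section \<open>The category of small double categories\<close>

text \<open>Smallness is relative to a universe, given by a type \<open>'a\<close> of potential elements and a
  cardinal \<open>\<kappa>\<close>: the four carriers are sets of elements of \<open>'a\<close> of cardinality less than \<open>\<kappa>\<close>.
  If \<open>\<kappa>\<close> is the cardinality of \<open>'a\<close> and is inaccessible, this is smallness in the sense of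
  a Grothendieck universe.

  The structure maps are required to be \<open>undefined\<close> outside their domains. Without this,
  equality of records would distinguish double categories (and double functors) that
  differ only in irrelevant values.\<close>

type_synonym 'a small_dblcat = "('a, 'a, 'a, 'a) dblcat"
type_synonym 'a small_dblfun = "('a, 'a, 'a, 'a, 'a, 'a, 'a, 'a) dblfun"
type_synonym 'a dblarrow = "'a small_dblcat \<times> 'a small_dblfun \<times> 'a small_dblcat"

definition extensional_cat :: "('o, 'm) cat \<Rightarrow> bool" where
  "extensional_cat C \<longleftrightarrow> Src C \<in> extensional (Arr C) \<and> Tgt C \<in> extensional (Arr C) \<and>
     Idn C \<in> extensional (Obj C) \<and>
     (\<forall>f g. \<not> (f \<in> Arr C \<and> g \<in> Arr C \<and> Tgt C f = Src C g) \<longrightarrow> Seq C f g = undefined)"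

definition extensional_dblcat :: "('o, 'h, 'v, 's) dblcat \<Rightarrow> bool" where
  "extensional_dblcat A \<longleftrightarrow> extensional_cat (hor_cat A) \<and> extensional_cat (ver_cat A) \<and>
     extensional_cat (hsq_cat A) \<and> extensional_cat (vsq_cat A)"

definition extensional_dblfun ::
  "('o, 'h, 'v, 's) dblcat \<Rightarrow> ('o, 'h, 'v, 's, 'p, 'i, 'w, 't) dblfun \<Rightarrow> bool" where
  "extensional_dblfun A F \<longleftrightarrow> dob F \<in> extensional (Ob A) \<and> dhor F \<in> extensional (Hor A) \<and>
     dver F \<in> extensional (Ver A) \<and> dsq F \<in> extensional (Sq A)"

definition small_carriers :: "'k rel \<Rightarrow> ('o, 'h, 'v, 's) dblcat \<Rightarrow> bool" where
  "small_carriers \<kappa> A \<longleftrightarrow> |Ob A| <o \<kappa> \<and> |Hor A| <o \<kappa> \<and> |Ver A| <o \<kappa> \<and> |Sq A| <o \<kappa>"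

definition dblfun_id :: "('o, 'h, 'v, 's) dblcat \<Rightarrow> ('o, 'h, 'v, 's, 'o, 'h, 'v, 's) dblfun" where
  "dblfun_id A = \<lparr>dob = (\<lambda>x \<in> Ob A. x), dhor = (\<lambda>x \<in> Hor A. x), dver = (\<lambda>x \<in> Ver A. x),
     dsq = (\<lambda>x \<in> Sq A. x)\<rparr>"

definition dblfun_seq :: "('o, 'h, 'v, 's) dblcat \<Rightarrow>
    ('o, 'h, 'v, 's, 'p, 'i, 'w, 't) dblfun \<Rightarrow> ('p, 'i, 'w, 't, 'q, 'j, 'x, 'r) dblfun \<Rightarrow>
    ('o, 'h, 'v, 's, 'q, 'j, 'x, 'r) dblfun" where
  "dblfun_seq A F G =
     \<lparr>dob = compose (Ob A) (dob G) (dob F), dhor = compose (Hor A) (dhor G) (dhor F),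
      dver = compose (Ver A) (dver G) (dver F), dsq = compose (Sq A) (dsq G) (dsq F)\<rparr>"

definition DblCat :: "'k rel \<Rightarrow> ('a small_dblcat, 'a dblarrow) cat" where
  "DblCat \<kappa> =
     (let Objects = {A. double_category A \<and> extensional_dblcat A \<and> small_carriers \<kappa> A} in
      \<lparr>Obj = Objects,
       Arr = {(A, F, B). A \<in> Objects \<and> B \<in> Objects \<and> double_functor A B F \<and> extensional_dblfun A F},
       Src = (\<lambda>(A, F, B). A), Tgt = (\<lambda>(A, F, B). B),
       Idn = (\<lambda>A. (A, dblfun_id A, A)),
       Seq = (\<lambda>(A, F, B) (A', G, B'). (A, dblfun_seq A F G, B'))\<rparr>)"

text \<open>In the terminal double category the value \<open>undefined\<close> serves as the unique object, morphism
  and square, so the constantly \<open>undefined\<close> structure maps are total on the carriers; in the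
  empty one the same maps are the empty functions. Likewise for \<open>to_one\<close>, the unique double
  functor to the terminal double category.\<close>

definition undefined_structure ::
  "'o set \<Rightarrow> 'h set \<Rightarrow> 'v set \<Rightarrow> 's set \<Rightarrow> ('o, 'h, 'v, 's) dblcat" where
  "undefined_structure O0 H0 V0 S0 =
     \<lparr>Ob = O0, Hor = H0, Ver = V0, Sq = S0,
      hsrc = (\<lambda>_. undefined), htgt = (\<lambda>_. undefined),
      hid = (\<lambda>_. undefined), hseq = (\<lambda>_ _. undefined),
      vsrc = (\<lambda>_. undefined), vtgt = (\<lambda>_. undefined),
      vid = (\<lambda>_. undefined), vseq = (\<lambda>_ _. undefined),
      sqt = (\<lambda>_. undefined), sqb = (\<lambda>_. undefined), sql = (\<lambda>_. undefined), sqr = (\<lambda>_. undefined),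
      hidsq = (\<lambda>_. undefined), hpaste = (\<lambda>_ _. undefined),
      vidsq = (\<lambda>_. undefined), vpaste = (\<lambda>_ _. undefined)\<rparr>"

definition empty_dblcat :: "('o, 'h, 'v, 's) dblcat" where
  "empty_dblcat = undefined_structure {} {} {} {}"

definition one_dblcat :: "('o, 'h, 'v, 's) dblcat" where
  "one_dblcat = undefined_structure {undefined} {undefined} {undefined} {undefined}"

definition to_one :: "('o, 'h, 'v, 's, 'p, 'i, 'w, 't) dblfun" where
  "to_one = \<lparr>dob = (\<lambda>_. undefined), dhor = (\<lambda>_. undefined), dver = (\<lambda>_. undefined),
     dsq = (\<lambda>_. undefined)\<rparr>"

text \<open>A model structure is determined by its trivial fibrations and its fibrant objects, hence at
  most one \<open>M\<close> satisfies the following.\<close>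

definition is_DblCat_ctr :: "'k rel \<Rightarrow> ('a dblarrow) model \<Rightarrow> bool" where
  "is_DblCat_ctr \<kappa> M \<longleftrightarrow> model_category (DblCat \<kappa>) M \<and>
     fib M \<inter> weq M = {(A, F, B) \<in> Arr (DblCat \<kappa>). canonical_trivial_fibration A B F} \<and>
     {A. fibrant (DblCat \<kappa>) M A} =
       {A \<in> Obj (DblCat \<kappa>). gregarious_double_equivalence A (one_dblcat :: 'a small_dblcat) to_one}"


section \<open>The terminal category\<close>

definition one_cat :: "(unit, unit) cat" where
  "one_cat = \<lparr>Obj = {()}, Arr = {()}, Src = (\<lambda>_. ()), Tgt = (\<lambda>_. ()), Idn = (\<lambda>_. ()),
     Seq = (\<lambda>_ _. ())\<rparr>"

definition bang :: "('o, 'm, unit, unit) ftor" where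
  "bang = \<lparr>fobj = (\<lambda>_. ()), farr = (\<lambda>_. ())\<rparr>"

definition pick :: "('o, 'm) cat \<Rightarrow> 'o \<Rightarrow> (unit, unit, 'o, 'm) ftor" where
  "pick C X = \<lparr>fobj = (\<lambda>_. X), farr = (\<lambda>_. Idn C X)\<rparr>"

end

(* Over the terminal double category 1 the gregarious double equivalences are exactly the canonical
   trivial fibrations: a double category is fibrant iff it is non-empty, any two objects are joined
   by horizontal and vertical morphisms, and every boundary has a unique filler. So every fibrant
   object is trivially fibrant. Factoring A -> 1 as a trivial cofibration followed by a fibration
   then shows that A -> 1 is a weak equivalence for every A, and by two-out-of-three every double
   functor is one. The conditions for a Quillen equivalence with the terminal category are then
   immediate. *)

theory Submission
  imports Defs
begin

section \<open>The terminal category and its trivial model structure\<close>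

lemma category_one_cat: "category one_cat"
  by standard (auto simp: one_cat_def hom_def)

lemma opposite_one_cat: "opposite one_cat = one_cat"
  by (simp add: opposite_def one_cat_def)

lemma Arr_one_cat: "Arr one_cat = UNIV"
  by (simp add: one_cat_def UNIV_unit)

lemma finite_limits_one_cat: "has_finite_limits one_cat"
  unfolding has_finite_limits_def is_limit_def is_cone_def
  by (auto simp: one_cat_def hom_def)

lemma iso_arrow_one_cat: "iso_arrow one_cat f"
  by (auto simp: iso_arrow_def one_cat_def hom_def)

lemma lifts_against_one_cat: "lifts_against one_cat i p"
  by (auto simp: lifts_against_def one_cat_def hom_def)

lemma model_category_one_cat: "model_category one_cat (trivial_model one_cat)"
proof -
  \<comment> \<open>The only arrow is an isomorphism, so trivial (co)fibrations coincide with
    (co)fibrations, and both factorization systems demanded by a model structure are this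
    one.\<close>
  have wfs: "weak_factorization_system one_cat {()} {()}"
    unfolding weak_factorization_system_def
    by (auto simp: lifts_against_one_cat) (auto simp: one_cat_def)
  interpret category one_cat
    by (rule category_one_cat)
  show ?thesis
    by standard
      (use wfs in \<open>auto simp: trivial_model_def iso_arrow_one_cat Arr_one_cat UNIV_unit has_finite_colimits_def
        opposite_one_cat finite_limits_one_cat two_out_of_three_def\<close>)
qed

text \<open>Both sides are always true: a record of maps into \<open>unit\<close> has only one
  value, and every functor law in \<open>one_cat\<close> is an equation in
  \<open>unit\<close>.\<close>

lemma (in category) is_functor_bang: "is_functor C one_cat H \<longleftrightarrow> H = bang"
proof -
  interpret one: category one_cat
    by (rule category_one_cat)
  have "is_functor C one_cat H"
    by standard (auto simp: one_cat_def hom_def)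
  moreover have "H = bang"
    by (cases H) (simp add: bang_def fun_eq_iff)
  ultimately show ?thesis
    by simp
qed

lemma (in category) is_functor_pick:
  assumes "X \<in> Obj C"
  shows "is_functor one_cat C (pick C X)"
proof -
  interpret one: category one_cat
    by (rule category_one_cat)
  show ?thesis
    using assms idn_hom[OF assms] idn_left[OF idn_hom[OF assms]]
    by unfold_locales (auto simp: pick_def)
qed

section \<open>Adjunctions given by terminal and initial objects\<close>

lemma hom_opposite: "hom (opposite C) X Y = hom C Y X"
  by (auto simp: hom_def opposite_def)

text \<open>Naturality of the unit and the triangle identity in \<open>C\<close> compare two
  morphisms into \<open>T\<close>, so they hold by uniqueness; the remaining laws live in
  \<open>one_cat\<close>.\<close>

lemma (in category) adjunction_terminal:
  assumes T: "is_terminal C T" and unit: "\<And>X. X \<in> Obj C \<Longrightarrow> unit X \<in> hom C X T"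
  shows "adjunction C one_cat bang (pick C T) unit (\<lambda>_. ())"
proof -
  have TC: "T \<in> Obj C" and uniq: "\<And>X f g. \<lbrakk>f \<in> hom C X T; g \<in> hom C X T\<rbrakk> \<Longrightarrow> f = g"
    using T src_closed unfolding is_terminal_def hom_def by blast+
  interpret bang: is_functor C one_cat bang
    by (simp add: is_functor_bang)
  interpret pick: is_functor one_cat C "pick C T"
    by (rule is_functor_pick[OF TC])
  show ?thesis
  proof
    fix f X X' assume f: "f \<in> hom C X X'"
    then have "X \<in> Obj C" "X' \<in> Obj C"
      using src_closed tgt_closed by (auto simp: hom_def)
    then show "Seq C f (unit X') = Seq C (unit X) (farr (pick C T) (farr bang f))"
      using f by (intro uniq seq_hom unit) (auto simp: pick_def intro: unit idn_hom TC seq_hom)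
  next
    fix Y :: unit
    show "Seq C (unit (fobj (pick C T) Y)) (farr (pick C T) ()) = Idn C (fobj (pick C T) Y)"
      using idn_right[OF unit[OF TC]] uniq[OF unit[OF TC] idn_hom[OF TC]] by (simp add: pick_def)
  qed (use unit in \<open>auto simp: pick_def one_cat_def hom_def\<close>)
qed

lemma (in category) adjunction_initial:
  assumes I: "is_terminal (opposite C) I" and counit: "\<And>X. X \<in> Obj C \<Longrightarrow> counit X \<in> hom C I X"
  shows "adjunction one_cat C (pick C I) bang (\<lambda>_. ()) counit"
proof -
  have IC: "I \<in> Obj C" and uniq: "\<And>X f g. \<lbrakk>f \<in> hom C I X; g \<in> hom C I X\<rbrakk> \<Longrightarrow> f = g"
    using I tgt_closed unfolding is_terminal_def hom_opposite
    by (auto simp: opposite_def hom_def)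
  interpret bang: is_functor C one_cat bang
    by (simp add: is_functor_bang)
  interpret pick: is_functor one_cat C "pick C I"
    by (rule is_functor_pick[OF IC])
  show ?thesis
  proof
    fix f X X' assume f: "f \<in> hom C X X'"
    then have "X \<in> Obj C" "X' \<in> Obj C"
      using src_closed tgt_closed by (auto simp: hom_def)
    then show "Seq C (farr (pick C I) (farr bang f)) (counit X') = Seq C (counit X) f"
      using f by (intro uniq) (auto simp: pick_def intro: counit idn_hom IC seq_hom)
  next
    fix X :: unit
    show "Seq C (farr (pick C I) ()) (counit (fobj (pick C I) X)) = Idn C (fobj (pick C I) X)"
      using idn_left[OF counit[OF IC]] uniq[OF counit[OF IC] idn_hom[OF IC]] by (simp add: pick_def)
  qed (use counit in \<open>auto simp: pick_def one_cat_def hom_def\<close>)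
qed

text \<open>An identity lifts against every morphism, the upper side of the lifting problem being
  itself the diagonal. This will show that \<open>pick C I\<close> preserves cofibrations and
  trivial cofibrations.\<close>

lemma (in category) idn_mem_left_class:
  assumes "weak_factorization_system C L R" "X \<in> Obj C"
  shows "Idn C X \<in> L"
proof -
  have idn: "Idn C X \<in> Arr C" "Src C (Idn C X) = X" "Tgt C (Idn C X) = X"
    using idn_hom[OF assms(2)] by (auto simp: hom_def)
  have "lifts_against C (Idn C X) p" for p
    unfolding lifts_against_def idn by (metis idn_left)
  then show ?thesis
    using assms(1) idn unfolding weak_factorization_system_def by blast
qed

section \<open>Model categories in which every morphism is a weak equivalence\<close>

context model_category
begin

text \<open>The middle object of the factorization is a fibrant replacement of \<open>X\<close>, so
  the assumption about fibrant objects applies to the second factor, and the first is a weak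
  equivalence by choice.\<close>

lemma to_terminal_weq:
  assumes T: "is_terminal C T"
    and fibrant_weq: "\<And>X f. \<lbrakk>fibrant C M X; f \<in> hom C X T\<rbrakk> \<Longrightarrow> f \<in> weq M"
    and f: "f \<in> hom C X T"
  shows "f \<in> weq M"
proof -
  have "f \<in> Arr C"
    using f by (simp add: hom_def)
  then obtain i p where i: "i \<in> cof M \<inter> weq M" and p: "p \<in> fib M"
    and ip: "Tgt C i = Src C p" "Seq C i p = f"
    using trivial_cof_fib unfolding weak_factorization_system_def by blast
  have arr: "i \<in> Arr C" "p \<in> Arr C"
    using i p weq_arr trivial_cof_fib unfolding weak_factorization_system_def by blast+
  \<comment> \<open>Comparing the targets of \<open>Seq C i p\<close> and \<open>f\<close> shows
    that \<open>p\<close> ends at \<open>T\<close>.\<close>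
  have "Seq C i p \<in> hom C (Src C i) (Tgt C p)"
    using arr ip by (intro seq_hom[of _ _ "Tgt C i"]) (auto simp: hom_def)
  then have pT: "p \<in> hom C (Src C p) T"
    using f ip arr by (auto simp: hom_def)
  then have "fibrant C M (Src C p)"
    using p T arr src_closed unfolding fibrant_def by blast
  then have "p \<in> weq M"
    using fibrant_weq pT by blast
  then show ?thesis
    using weq_two_out_of_three i arr ip unfolding two_out_of_three_def by blast
qed

text \<open>Compose \<open>f\<close> with the morphism \<open>g\<close> from its target to
  \<open>T\<close>: both \<open>g\<close> and the composite end at \<open>T\<close>, hence are weak
  equivalences, and two-out-of-three cancels \<open>g\<close>.\<close>

lemma all_weq:
  assumes T: "is_terminal C T"
    and fibrant_weq: "\<And>X f. \<lbrakk>fibrant C M X; f \<in> hom C X T\<rbrakk> \<Longrightarrow> f \<in> weq M"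
  shows "weq M = Arr C"
proof (rule equalityI[OF weq_arr], rule subsetI)
  fix f assume f: "f \<in> Arr C"
  then have "Tgt C f \<in> Obj C"
    by (rule tgt_closed)
  then obtain g where g: "g \<in> hom C (Tgt C f) T"
    using T unfolding is_terminal_def by blast
  have fg: "Seq C f g \<in> hom C (Src C f) T"
    using f g by (intro seq_hom[of _ _ "Tgt C f"]) (auto simp: hom_def)
  have "g \<in> weq M" "Seq C f g \<in> weq M"
    using to_terminal_weq[OF T _ g] to_terminal_weq[OF T _ fg] fibrant_weq by blast+
  moreover have "g \<in> Arr C" "Tgt C f = Src C g"
    using g by (auto simp: hom_def)
  ultimately show "f \<in> weq M"
    using weq_two_out_of_three f unfolding two_out_of_three_def by blast
qed

lemma quillen_equivalence_initial:
  assumes I: "is_terminal (opposite C) I" and weq: "weq M = Arr C"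
  shows "quillen_equivalence one_cat (trivial_model one_cat) C M (pick C I) bang"
proof -
  obtain counit where counit: "\<And>X. X \<in> Obj C \<Longrightarrow> counit X \<in> hom C I X"
    using I unfolding is_terminal_def hom_opposite by (simp add: opposite_def) metis
  interpret one: model_category one_cat "trivial_model one_cat"
    by (rule model_category_one_cat)
  interpret adjunction one_cat C "pick C I" bang "\<lambda>_. ()" counit
    by (rule adjunction_initial[OF I counit])
  have "I \<in> Obj C"
    using I by (simp add: is_terminal_def opposite_def)
  \<comment> \<open>The left adjoint sends the only arrow of \<open>one_cat\<close> to this
    identity, so these memberships are all that preservation of cofibrations and trivial
    cofibrations requires.\<close>
  then have "Idn C I \<in> cof M" "Idn C I \<in> cof M \<inter> weq M"
    using idn_mem_left_class trivial_cof_fib cof_trivial_fib by blast+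
  then have "quillen_adjunction one_cat (trivial_model one_cat) C M (pick C I) bang (\<lambda>_. ()) counit"
    by unfold_locales (auto simp: pick_def)
  then show ?thesis
    unfolding quillen_equivalence_def
    using weq by (auto simp: hom_def trivial_model_def iso_arrow_one_cat)
qed

lemma quillen_equivalence_terminal:
  assumes T: "is_terminal C T" and weq: "weq M = Arr C"
  shows "quillen_equivalence C M one_cat (trivial_model one_cat) bang (pick C T)"
proof -
  obtain unit where unit: "\<And>X. X \<in> Obj C \<Longrightarrow> unit X \<in> hom C X T"
    using T unfolding is_terminal_def by metis
  interpret one: model_category one_cat "trivial_model one_cat"
    by (rule model_category_one_cat)
  interpret adjunction C one_cat bang "pick C T" unit "\<lambda>_. ()"
    by (rule adjunction_terminal[OF T unit])
  have "quillen_adjunction C M one_cat (trivial_model one_cat) bang (pick C T) unit (\<lambda>_. ())"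
    by unfold_locales (simp_all add: trivial_model_def iso_arrow_one_cat Arr_one_cat)
  \<comment> \<open>This is the adjunct of the only arrow out of \<open>fobj bang X\<close>, which
    is itself an isomorphism; the Quillen condition thus asks that this adjunct be a weak
    equivalence.\<close>
  moreover have "Seq C (unit X) (Idn C T) \<in> weq M" if "X \<in> Obj C" for X
    using unit[OF that] idn_right weq by (auto simp: hom_def)
  ultimately show ?thesis
    unfolding quillen_equivalence_def
    by (auto simp: trivial_model_def iso_arrow_one_cat cofibrant_def pick_def)
qed

end

section \<open>The empty and the terminal double category\<close>

definition undefined_cat :: "'o set \<Rightarrow> 'm set \<Rightarrow> ('o, 'm) cat" where
  "undefined_cat O0 M0 = \<lparr>Obj = O0, Arr = M0, Src = (\<lambda>_. undefined), Tgt = (\<lambda>_. undefined),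
     Idn = (\<lambda>_. undefined), Seq = (\<lambda>_ _. undefined)\<rparr>"

text \<open>All four underlying categories have the same shape, so the functor axioms for both
  double categories reduce to a few facts about \<open>undefined_cat\<close>.\<close>

lemma undefined_structure_cats [simp]:
  "hor_cat (undefined_structure O0 H0 V0 S0) = undefined_cat O0 H0"
  "ver_cat (undefined_structure O0 H0 V0 S0) = undefined_cat O0 V0"
  "hsq_cat (undefined_structure O0 H0 V0 S0) = undefined_cat V0 S0"
  "vsq_cat (undefined_structure O0 H0 V0 S0) = undefined_cat H0 S0"
  by (simp_all add: undefined_structure_def undefined_cat_def hor_cat_def ver_cat_def hsq_cat_def
      vsq_cat_def)

lemma category_undefined_empty: "category (undefined_cat {} {})"
  by standard (auto simp: undefined_cat_def hom_def)

lemma category_undefined_one: "category (undefined_cat {undefined} {undefined})"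
  by standard (auto simp: undefined_cat_def hom_def)

lemma is_functor_undefined_empty:
  assumes "category C"
  shows "is_functor (undefined_cat {} {}) C F"
  using category_undefined_empty assms
  by (intro is_functor.intro is_functor_axioms.intro) (auto simp: undefined_cat_def hom_def)

lemma is_functor_undefined_one:
  assumes "category C"
  shows "is_functor C (undefined_cat {undefined} {undefined})
    \<lparr>fobj = (\<lambda>_. undefined), farr = (\<lambda>_. undefined)\<rparr>"
  using category_undefined_one assms
  by (intro is_functor.intro is_functor_axioms.intro) (auto simp: undefined_cat_def hom_def)

lemma extensional_undefined_cat:
  "extensional_cat (undefined_cat {} {})" "extensional_cat (undefined_cat {undefined} {undefined})"
  by (auto simp: extensional_cat_def undefined_cat_def)

lemma (in double_category) underlying_categories:
  "category (hor_cat A)" "category (ver_cat A)" "category (hsq_cat A)" "category (vsq_cat A)"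
  using top_functor left_functor by (auto simp: is_functor_def)

lemma double_category_empty: "double_category empty_dblcat"
  unfolding empty_dblcat_def
  by (rule double_category.intro,
      simp_all add: is_functor_undefined_empty category_undefined_empty)
    (simp add: undefined_structure_def)

lemma double_category_one: "double_category one_dblcat"
proof -
  \<comment> \<open>Rewriting the fields first brings the functors in the axioms into the constant
    form of \<open>is_functor_undefined_one\<close>.\<close>
  have fields: "vsrc one_dblcat = (\<lambda>_. undefined)" "vtgt one_dblcat = (\<lambda>_. undefined)"
    "vid one_dblcat = (\<lambda>_. undefined)" "hsrc one_dblcat = (\<lambda>_. undefined)"
    "htgt one_dblcat = (\<lambda>_. undefined)" "hid one_dblcat = (\<lambda>_. undefined)"
    "sqt one_dblcat = (\<lambda>_. undefined)" "sqb one_dblcat = (\<lambda>_. undefined)"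
    "sql one_dblcat = (\<lambda>_. undefined)" "sqr one_dblcat = (\<lambda>_. undefined)"
    "hidsq one_dblcat = (\<lambda>_. undefined)" "vidsq one_dblcat = (\<lambda>_. undefined)"
    "hpaste one_dblcat = (\<lambda>_ _. undefined)" "vpaste one_dblcat = (\<lambda>_ _. undefined)"
    by (simp_all add: one_dblcat_def undefined_structure_def)
  show ?thesis
    by (rule double_category.intro; unfold fields)
      (simp_all add: one_dblcat_def is_functor_undefined_one category_undefined_one)
qed

text \<open>This is how the size bound enters: it makes the empty and the terminal double category
  objects of \<open>DblCat \<kappa>\<close>.\<close>

lemma small_finite:
  assumes "natLeq <o \<kappa>" "finite A"
  shows "|A| <o \<kappa>"
  using assms by (meson finite_iff_ordLess_natLeq ordLess_transitive)

lemma empty_in_DblCat: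
  assumes "natLeq <o \<kappa>"
  shows "empty_dblcat \<in> Obj (DblCat \<kappa>)"
proof -
  have "small_carriers \<kappa> empty_dblcat"
    by (simp add: small_carriers_def empty_dblcat_def undefined_structure_def small_finite[OF assms])
  moreover have "extensional_dblcat empty_dblcat"
    by (simp add: extensional_dblcat_def empty_dblcat_def extensional_undefined_cat)
  ultimately show ?thesis
    by (simp add: DblCat_def double_category_empty)
qed

lemma one_in_DblCat:
  assumes "natLeq <o \<kappa>"
  shows "one_dblcat \<in> Obj (DblCat \<kappa>)"
proof -
  have "small_carriers \<kappa> one_dblcat"
    by (simp add: small_carriers_def one_dblcat_def undefined_structure_def small_finite[OF assms])
  moreover have "extensional_dblcat one_dblcat"
    by (simp add: extensional_dblcat_def one_dblcat_def extensional_undefined_cat)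
  ultimately show ?thesis
    by (simp add: DblCat_def double_category_one)
qed

lemma double_functor_to_one:
  assumes "double_category A"
  shows "double_functor A one_dblcat to_one"
  using assms double_category_one
  by (intro double_functor.intro double_functor_axioms.intro)
    (simp_all add: one_dblcat_def to_one_def is_functor_undefined_one
      double_category.underlying_categories)

text \<open>On empty carriers the constantly \<open>undefined\<close> maps of \<open>to_one\<close>
  also represent the empty double functor.\<close>

lemma double_functor_from_empty:
  assumes "double_category A"
  shows "double_functor empty_dblcat A to_one"
  using assms double_category_empty
  by (intro double_functor.intro double_functor_axioms.intro)
    (simp_all add: empty_dblcat_def is_functor_undefined_empty
      double_category.underlying_categories)

lemma to_one_hom:
  fixes \<kappa> :: "'k rel" and A :: "'a small_dblcat"
  assumes "natLeq <o \<kappa>" "A \<in> Obj (DblCat \<kappa>)"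
  shows "(A, to_one, one_dblcat) \<in> hom (DblCat \<kappa>) A one_dblcat"
proof -
  have "extensional_dblfun A to_one"
    by (simp add: extensional_dblfun_def to_one_def extensional_def)
  moreover have "(one_dblcat :: 'a small_dblcat) \<in> Obj (DblCat \<kappa>)"
    by (rule one_in_DblCat[OF assms(1)])
  ultimately show ?thesis
    using assms(2) by (simp add: DblCat_def Let_def hom_def double_functor_to_one)
qed

lemma from_empty_hom:
  fixes \<kappa> :: "'k rel" and A :: "'a small_dblcat"
  assumes "natLeq <o \<kappa>" "A \<in> Obj (DblCat \<kappa>)"
  shows "(empty_dblcat, to_one, A) \<in> hom (DblCat \<kappa>) empty_dblcat A"
proof -
  have "extensional_dblfun empty_dblcat to_one"
    by (simp add: extensional_dblfun_def to_one_def extensional_def)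
  moreover have "(empty_dblcat :: 'a small_dblcat) \<in> Obj (DblCat \<kappa>)"
    by (rule empty_in_DblCat[OF assms(1)])
  ultimately show ?thesis
    using assms(2) by (simp add: DblCat_def Let_def hom_def double_functor_from_empty)
qed

lemma hom_DblCatE:
  assumes "f \<in> hom (DblCat \<kappa>) A B"
  obtains F where "f = (A, F, B)" "double_functor A B F" "extensional_dblfun A F"
  using assms by (auto simp: DblCat_def Let_def hom_def)

text \<open>On the carriers of \<open>A\<close> all values lie in \<open>{undefined}\<close>; off
  them extensionality forces the same value.\<close>

lemma double_functor_to_one_unique:
  assumes "double_functor A one_dblcat F" "extensional_dblfun A F"
  shows "F = to_one"
proof -
  interpret double_functor A one_dblcat F
    by (rule assms(1))
  have hom: "x \<in> hom C (Src C x) (Tgt C x)" if "x \<in> Arr C" for C :: "('x, 'y) cat" and x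
    using that by (simp add: hom_def)
  have "dob F x = undefined" if "x \<in> Ob A" for x
    using is_functor.fobj_closed[OF hor_functor, of x] that
    by (simp add: one_dblcat_def undefined_structure_def hor_cat_def)
  \<comment> \<open>Horizontal morphisms are the objects of \<open>vsq_cat\<close>, and vertical
    ones those of \<open>hsq_cat\<close>, so closure on objects suffices; only squares need the
    action on arrows.\<close>
  moreover have "dhor F x = undefined" if "x \<in> Hor A" for x
    using is_functor.fobj_closed[OF vsq_functor, of x] that
    by (simp add: one_dblcat_def undefined_structure_def vsq_cat_def)
  moreover have "dver F x = undefined" if "x \<in> Ver A" for x
    using is_functor.fobj_closed[OF hsq_functor, of x] that
    by (simp add: one_dblcat_def undefined_structure_def hsq_cat_def)
  moreover have "dsq F x = undefined" if "x \<in> Sq A" for x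
    using is_functor.farr_hom[OF hsq_functor hom, of x] that
    by (simp add: one_dblcat_def undefined_structure_def hsq_cat_def hom_def)
  ultimately have "dob F = (\<lambda>_. undefined)" "dhor F = (\<lambda>_. undefined)"
    "dver F = (\<lambda>_. undefined)" "dsq F = (\<lambda>_. undefined)"
    using assms(2) unfolding extensional_dblfun_def extensional_def fun_eq_iff by blast+
  then show ?thesis
    by (simp add: to_one_def)
qed

lemma double_functor_from_empty_unique:
  assumes "extensional_dblfun empty_dblcat F"
  shows "F = to_one"
  using assms
  by (simp add: extensional_dblfun_def extensional_def empty_dblcat_def undefined_structure_def
      to_one_def fun_eq_iff)

section \<open>The terminal and the initial object among double categories\<close>

lemma terminal_DblCat:
  fixes \<kappa> :: "'k rel"
  assumes "natLeq <o \<kappa>"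
  shows "is_terminal (DblCat \<kappa> :: ('a small_dblcat, 'a dblarrow) cat) one_dblcat"
  unfolding is_terminal_def
proof (intro conjI ballI one_in_DblCat[OF assms])
  fix A :: "'a small_dblcat" assume "A \<in> Obj (DblCat \<kappa>)"
  then have "(A, to_one, one_dblcat) \<in> hom (DblCat \<kappa>) A one_dblcat"
    by (rule to_one_hom[OF assms])
  then show "\<exists>!f. f \<in> hom (DblCat \<kappa>) A one_dblcat"
    by (rule ex1I) (metis hom_DblCatE double_functor_to_one_unique)
qed

lemma initial_DblCat:
  fixes \<kappa> :: "'k rel"
  assumes "natLeq <o \<kappa>"
  shows "is_terminal (opposite (DblCat \<kappa> :: ('a small_dblcat, 'a dblarrow) cat)) empty_dblcat"
proof -
  have "\<exists>!f. f \<in> hom (DblCat \<kappa>) empty_dblcat A" if "A \<in> Obj (DblCat \<kappa>)"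
    for A :: "'a small_dblcat"
    using from_empty_hom[OF assms that]
    by (rule ex1I) (metis hom_DblCatE double_functor_from_empty_unique)
  then show ?thesis
    using empty_in_DblCat[OF assms] unfolding is_terminal_def hom_opposite
    by (simp add: opposite_def)
qed

section \<open>Gregarious double equivalences to the terminal double category\<close>

lemma hom_one:
  "hom (hor_cat one_dblcat) undefined undefined = {undefined}"
  "hom (ver_cat one_dblcat) undefined undefined = {undefined}"
  by (simp_all add: one_dblcat_def undefined_cat_def hom_def)

text \<open>Essential fullness provides a lift, up to isomorphism, of the only morphism of
  \<open>one_dblcat\<close>; the existence of that lift is the claim.\<close>

lemma essentially_full_to_one:
  assumes "essentially_full_on_morphisms (horizontal_2cat A) (horizontal_2cat one_dblcat)
      (horizontal_2fun to_one)"
    and "X \<in> Ob A" "Y \<in> Ob A"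
  shows "hom (hor_cat A) X Y \<noteq> {}"
proof -
  have obj: "X \<in> Obj (under (horizontal_2cat A))" "Y \<in> Obj (under (horizontal_2cat A))"
    using assms(2,3) by (simp_all add: horizontal_2cat_def hor_cat_def)
  have "undefined \<in> hom (under (horizontal_2cat one_dblcat))
      (on_obj (horizontal_2fun to_one) X) (on_obj (horizontal_2fun to_one) Y)"
    by (simp add: horizontal_2cat_def horizontal_2fun_def to_one_def hom_one)
  from assms(1)[unfolded essentially_full_on_morphisms_def, rule_format, OF obj this]
  show ?thesis
    by (auto simp: horizontal_2cat_def)
qed

text \<open>Since \<open>vertical_2cat\<close> is defined by transposition, this lets the vertical
  case be the horizontal one for \<open>transpose A\<close>.\<close>

lemma transpose_one: "transpose one_dblcat = one_dblcat" "transpose_fun to_one = to_one"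
  by (simp_all add: transpose_def transpose_fun_def one_dblcat_def undefined_structure_def to_one_def)

text \<open>Both notions demand full faithfulness on squares. Over singletons, surjectivity on
  objects and fullness only ask that \<open>A\<close> and its hom-sets be non-empty, since a
  constant map on a non-empty set hits the single value.\<close>

lemma gregarious_to_one_canonical:
  fixes A :: "('o, 'h, 'v, 's) dblcat"
  assumes "gregarious_double_equivalence A (one_dblcat :: ('p, 'i, 'w, 't) dblcat) to_one"
  shows "canonical_trivial_fibration A (one_dblcat :: ('p, 'i, 'w, 't) dblcat) to_one"
proof -
  let ?one = "one_dblcat :: ('p, 'i, 'w, 't) dblcat"
  let ?F = "to_one :: ('o, 'h, 'v, 's, 'p, 'i, 'w, 't) dblfun"
  note gregarious = assms[unfolded gregarious_double_equivalence_def vertical_2cat_def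
      vertical_2fun_def transpose_one]
  note hor = gregarious[THEN conjunct2, THEN conjunct2, THEN conjunct1]
  note ver = gregarious[THEN conjunct2, THEN conjunct2, THEN conjunct2, THEN conjunct1]
  \<comment> \<open>The gregarious equivalence reaching the single object of
    \<open>one_dblcat\<close> starts at the image of some object of \<open>A\<close>.\<close>
  have "Ob A \<noteq> {}"
    using gregarious[THEN conjunct2, THEN conjunct1] by (auto simp: one_dblcat_def undefined_structure_def)
  then have "dob ?F ` Ob A = Ob ?one"
    by (simp add: to_one_def image_constant_conv one_dblcat_def undefined_structure_def)
  moreover have "dhor ?F ` hom (hor_cat A) X Y = hom (hor_cat ?one) (dob ?F X) (dob ?F Y)"
    if "X \<in> Ob A" "Y \<in> Ob A" for X Y
    using essentially_full_to_one[OF hor that] by (simp add: to_one_def image_constant_conv hom_one)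
  moreover have "dver ?F ` hom (ver_cat A) X Y = hom (ver_cat ?one) (dob ?F X) (dob ?F Y)"
    if "X \<in> Ob A" "Y \<in> Ob A" for X Y
  proof -
    have "hor_cat (transpose A) = ver_cat A" "Ob (transpose A) = Ob A"
      by (simp_all add: transpose_def hor_cat_def ver_cat_def)
    then show ?thesis
      using essentially_full_to_one[OF ver, of X Y] that
      by (simp add: to_one_def image_constant_conv hom_one)
  qed
  ultimately show ?thesis
    using gregarious by (simp add: canonical_trivial_fibration_def)
qed

theorem theorem8p10:
  fixes \<kappa> :: "'k rel" and M :: "('a dblarrow) model"
  assumes "Card_order \<kappa>" and "natLeq <o \<kappa>"
    and "is_DblCat_ctr \<kappa> M"
  shows "(\<forall>H. is_functor (DblCat \<kappa> :: ('a small_dblcat, 'a dblarrow) cat) one_cat H \<longleftrightarrow> H = bang) \<and>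
    quillen_equivalence one_cat (trivial_model one_cat) (DblCat \<kappa>) M
      (pick (DblCat \<kappa>) empty_dblcat) bang \<and>
    quillen_equivalence (DblCat \<kappa>) M one_cat (trivial_model one_cat)
      bang (pick (DblCat \<kappa>) one_dblcat)"
proof -
  note ctr = assms(3)[unfolded is_DblCat_ctr_def]
  note trivial_fibrations = ctr[THEN conjunct2, THEN conjunct1]
  note fibrant_objects = ctr[THEN conjunct2, THEN conjunct2]
  interpret model_category "DblCat \<kappa>" M
    by (rule ctr[THEN conjunct1])
  have T: "is_terminal (DblCat \<kappa> :: ('a small_dblcat, 'a dblarrow) cat) one_dblcat"
    by (rule terminal_DblCat[OF assms(2)])
  have fibrant_weq: "f \<in> weq M"
    if X: "fibrant (DblCat \<kappa>) M X" and f: "f \<in> hom (DblCat \<kappa>) X one_dblcat" for X f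
  proof -
    obtain F where F: "f = (X, F, one_dblcat)" "double_functor X one_dblcat F" "extensional_dblfun X F"
      using f by (rule hom_DblCatE)
    have "gregarious_double_equivalence X (one_dblcat :: 'a small_dblcat) to_one"
      using X fibrant_objects by blast
    \<comment> \<open>The fibrant objects are described through \<open>to_one\<close>, whereas
      \<open>f\<close> carries some \<open>F\<close>; uniqueness of double functors to
      \<open>one_dblcat\<close> identifies the two.\<close>
    then have "canonical_trivial_fibration X (one_dblcat :: 'a small_dblcat) F"
      using gregarious_to_one_canonical double_functor_to_one_unique[OF F(2,3)] by metis
    then have "f \<in> fib M \<inter> weq M"
      using f F(1) unfolding trivial_fibrations by (simp add: hom_def)
    then show ?thesis
      by simp
  qed
  have weq: "weq M = Arr (DblCat \<kappa>)"
    by (rule all_weq[OF T fibrant_weq])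
  show ?thesis
    using is_functor_bang quillen_equivalence_terminal[OF T weq]
      quillen_equivalence_initial[OF initial_DblCat[OF assms(2)] weq] by simp
qed

end
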